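(* Let $h$ be a unit cost function, let $\{y(t),p_0(t),p(t)\mid t=1,\dots,T\}$ be time series with $y(t)\ge0$, $p_0(t)>0$, $p(t)=(p_1(t),\dots,p_n(t))>0$, and let $w(t)$, $t=1,\dots,T$, be the associated vectors indexed by the domains $G\in\Lambda_h(\widehat p)$. If the moment problem $$\int_{\mathbb R^n_+}\theta\bigl(p_0(t)-h(p(t)\circ x)\bigr)\,\mu(dx)=y(t)\qquad(t=1,\dots,T)$$ has a solution $\mu$ in the class of non-negative absolutely continuous measures, then for any $\Omega_1,\Omega_2\subseteq\{1,\dots,T\}$ the (componentwise) inequality $$\sum_{t\in\Omega_1}w(t)\ge\sum_{t\in\Omega_2}w(t)$$ implies the inequality $$\sum_{t\in\Omega_1}y(t)\ge\sum_{t\in\Omega_2}y(t).$$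
   Context: $\mathbb R^n_+=\{x\in\mathbb R^n: x_i\ge0\}$; $p\circ x=(p_1x_1,\dots,p_nx_n)$; $\theta(s)=1$ for $s\ge0$ and $\theta(s)=0$ for $s<0$; $p(t)>0$ means all components positive. Unit cost function: a function $h$ on $\mathbb R^n_+$, continuous and positive on $\operatorname{int}\mathbb R^n_+$, with $h(\lambda x)=\lambda h(x)$ for $\lambda>0$. Absolutely continuous means with respect to Lebesgue measure. Put $\widehat p(t)=p(t)/p_0(t)$. The hypersurfaces $\{x\mid h(p(t)\circ x)=p_0(t)\}$, $t=1,\dots,T$, partition $\mathbb R^n_+$; $\Lambda_h(\widehat p)$ is the set of domains of this partition, i.e. of the non-empty sets among $$G_S=\{x\in\operatorname{int}\mathbb R^n_+\mid h(p(t)\circ x)>p_0(t)\ \forall t\in S,\ \ h(p(t)\circ x)<p_0(t)\ \forall t\in\{1,\dots,T\}\setminus S\},\quad S\subseteq\{1,\dots,T\}.$$ The spectrum of $G\in\Lambda_h(\widehat p)$ is $Z(G)=(Z_1(G),\dots,Z_T(G))$ with $Z_t(G)=1$ if $p_0(t)>h(p(t)\circ x)$ for all $x\in G$, and $Z_t(G)=0$ if $p_0(t)<h(p(t)\circ x)$ for all $x\in G$. For $t=1,\dots,T$ put $w(t)=(w_G(t)\mid G\in\Lambda_h(\widehat p))$ with $w_G(t)=Z_t(G)\in\{0,1\}$. Empty sums are zero. *)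

theory Defs
  imports "HOL-Analysis.Analysis"
begin

text \<open>
  The dimension \<open>n\<close> is the cardinality of the index type \<open>'n\<close>. The product
  \<open>p \<circ> x = (p\<^sub>1 x\<^sub>1, \<dots>, p\<^sub>n x\<^sub>n)\<close> is the multiplication \<open>p * x\<close> of the library, which
  is componentwise on \<^typ>\<open>real ^ 'n\<close>. Time runs over \<open>{1..T}\<close>; values of the time
  series outside this range play no role.
\<close>

definition nonneg_orthant :: "(real ^ 'n) set" where
  "nonneg_orthant = {x. \<forall>i. 0 \<le> x $ i}"

definition unit_cost_function :: "(real ^ 'n \<Rightarrow> real) \<Rightarrow> bool" where
  "unit_cost_function h \<longleftrightarrow>
     continuous_on (interior nonneg_orthant) h \<and>
     (\<forall>x \<in> interior nonneg_orthant. 0 < h x) \<and>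
     (\<forall>c > 0. \<forall>x \<in> nonneg_orthant. h (c *\<^sub>R x) = c * h x)"

definition theta :: "real \<Rightarrow> real" where
  "theta s = (if 0 \<le> s then 1 else 0)"

definition price_cell ::
  "(real ^ 'n \<Rightarrow> real) \<Rightarrow> (nat \<Rightarrow> real) \<Rightarrow> (nat \<Rightarrow> real ^ 'n) \<Rightarrow> nat \<Rightarrow> nat set \<Rightarrow> (real ^ 'n) set"
where
  "price_cell h p0 p T S =
     {x \<in> interior nonneg_orthant.
        (\<forall>t \<in> S. h (p t * x) > p0 t) \<and> (\<forall>t \<in> {1..T} - S. h (p t * x) < p0 t)}"

definition domains ::
  "(real ^ 'n \<Rightarrow> real) \<Rightarrow> (nat \<Rightarrow> real) \<Rightarrow> (nat \<Rightarrow> real ^ 'n) \<Rightarrow> nat \<Rightarrow> (real ^ 'n) set set"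
where
  "domains h p0 p T = {price_cell h p0 p T S | S. S \<subseteq> {1..T} \<and> price_cell h p0 p T S \<noteq> {}}"

text \<open>
  The last branch below is never reached for \<open>G \<in> domains h p0 p T\<close> and \<open>t \<in> {1..T}\<close>, and
  the first two conditions then exclude each other; see \<open>spectrum_price_cell\<close>.
\<close>

definition spectrum ::
  "(real ^ 'n \<Rightarrow> real) \<Rightarrow> (nat \<Rightarrow> real) \<Rightarrow> (nat \<Rightarrow> real ^ 'n) \<Rightarrow> (real ^ 'n) set \<Rightarrow> nat \<Rightarrow> real"
where
  "spectrum h p0 p G t =
     (if \<forall>x \<in> G. p0 t > h (p t * x) then 1
      else if \<forall>x \<in> G. p0 t < h (p t * x) then 0
      else undefined)"

lemma spectrum_price_cell:
  assumes "price_cell h p0 p T S \<noteq> {}" "t \<in> {1..T}"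
  shows "spectrum h p0 p (price_cell h p0 p T S) t = (if t \<in> S then 0 else 1)"
proof -
  obtain x where x: "x \<in> price_cell h p0 p T S"
    using assms(1) by blast
  show ?thesis
  proof (cases "t \<in> S")
    case True
    then have gt: "\<forall>x \<in> price_cell h p0 p T S. p0 t < h (p t * x)"
      by (simp add: price_cell_def)
    then have "\<not> (\<forall>x \<in> price_cell h p0 p T S. p0 t > h (p t * x))"
      using x by (meson less_asym)
    with gt True show ?thesis
      by (simp add: spectrum_def)
  next
    case False
    then have "\<forall>x \<in> price_cell h p0 p T S. p0 t > h (p t * x)"
      using assms(2) by (simp add: price_cell_def)
    with False show ?thesis
      by (simp add: spectrum_def)
  qed
qed

definition spectrum_vector ::
  "(real ^ 'n \<Rightarrow> real) \<Rightarrow> (nat \<Rightarrow> real) \<Rightarrow> (nat \<Rightarrow> real ^ 'n) \<Rightarrow> nat \<Rightarrow> (real ^ 'n) set \<Rightarrow> real"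
where
  "spectrum_vector h p0 p t G = spectrum h p0 p G t"

text \<open>
  Measures on the orthant are taken on the Lebesgue measurable sets. An absolutely
  continuous Borel measure extends uniquely to these, and a unit cost function, which may
  be arbitrary on the (Lebesgue null) boundary up to homogeneity, need only be Lebesgue
  measurable. Neither finiteness nor \<open>\<sigma>\<close>-finiteness is required.
\<close>

definition abs_cont_measure :: "(real ^ 'n) measure \<Rightarrow> bool" where
  "abs_cont_measure \<mu> \<longleftrightarrow>
     sets \<mu> = sets (lebesgue_on nonneg_orthant) \<and>
     absolutely_continuous (lebesgue_on nonneg_orthant) \<mu>"

text \<open>
  \<open>has_bochner_integral\<close> says that the integral exists, is finite and equals \<open>y t\<close>, whereas
  \<open>integral\<^sup>L\<close> would be \<open>0\<close> for a non-integrable function.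
\<close>

definition solves_moment_problem ::
  "(real ^ 'n \<Rightarrow> real) \<Rightarrow> (nat \<Rightarrow> real) \<Rightarrow> (nat \<Rightarrow> real) \<Rightarrow> (nat \<Rightarrow> real ^ 'n) \<Rightarrow> nat \<Rightarrow>
     (real ^ 'n) measure \<Rightarrow> bool"
where
  "solves_moment_problem h y p0 p T \<mu> \<longleftrightarrow>
     (\<forall>t \<in> {1..T}. has_bochner_integral \<mu> (\<lambda>x. theta (p0 t - h (p t * x))) (y t))"

end

theory Submission
  imports Defs
begin

text \<open>
  By homogeneity, a ray from the origin meets the hypersurface \<open>h (p t * x) = p0 t\<close> at most
  once, so the hypersurface is a null set. Hence \<open>\<mu>\<close>-almost every point lies in a domain \<open>G\<close>,
  where \<open>theta (p0 t - h (p t * x))\<close> is the constant \<open>w\<^sub>G(t)\<close>; the inequality between the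
  vectors \<open>w(t)\<close> therefore holds almost everywhere between the integrands.
\<close>

lemma interior_nonneg_orthant:
  "interior (nonneg_orthant :: (real ^ 'n) set) = {x. \<forall>i. 0 < x $ i}"
proof (rule interior_unique)
  show "{x. \<forall>i. 0 < x $ i} \<subseteq> nonneg_orthant"
    by (auto simp: nonneg_orthant_def less_imp_le)
  show "open {x :: real ^ 'n. \<forall>i. 0 < x $ i}"
    by (simp add: Collect_all_eq open_INT open_halfspace_component_gt_cart)
  fix U :: "(real ^ 'n) set"
  assume "U \<subseteq> nonneg_orthant" and "open U"
  \<comment> \<open>The orthant is an intersection of closed half-spaces, so an open subset of it
    lies in the interior of each, which is the open half-space.\<close>
  then have "U \<subseteq> interior {x. 0 \<le> x $ i}" for i
    by (intro interior_maximal) (auto simp: nonneg_orthant_def)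
  then show "U \<subseteq> {x. \<forall>i. 0 < x $ i}"
    by (auto simp: interior_halfspace_component_ge)
qed

text \<open>A boundary point has a vanishing coordinate, so finitely many hyperplanes cover the
  boundary. Domains consist of interior points only, hence the boundary has to be discarded
  separately.\<close>

lemma negligible_orthant_boundary:
  "negligible (nonneg_orthant - interior nonneg_orthant :: (real ^ 'n) set)"
proof -
  have "nonneg_orthant - interior nonneg_orthant \<subseteq> (\<Union>i::'n. {x. x $ i = 0})"
    unfolding interior_nonneg_orthant by (auto simp: nonneg_orthant_def less_le)
  moreover have "negligible (\<Union>i::'n. {x :: real ^ 'n. x $ i = 0})"
    by (intro negligible_Union) (auto simp: negligible_standard_hyperplane_cart)
  ultimately show ?thesis
    by (rule negligible_subset[rotated])
qed

lemma continuous_on_unit_cost: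
  assumes "unit_cost_function h" and "\<And>i. 0 < q $ i"
  shows "continuous_on (interior nonneg_orthant) (\<lambda>x. h (q * x))"
proof (rule continuous_on_compose2[of "interior nonneg_orthant" h])
  show "continuous_on (interior nonneg_orthant) h"
    using assms(1) by (simp add: unit_cost_function_def)
  show "continuous_on (interior nonneg_orthant) (\<lambda>x. q * x)"
    unfolding times_vec_def by (intro continuous_intros)
  show "(\<lambda>x. q * x) ` interior nonneg_orthant \<subseteq> interior nonneg_orthant"
    using assms(2) by (auto simp: interior_nonneg_orthant)
qed

text \<open>The single crossing of each ray is the hypothesis of \<open>starlike_negligible\<close>,
  but that result also demands a closed set, and the level set is closed only relative to the open
  orthant. It is therefore cut into countably many closed pieces.\<close>

lemma negligible_unit_cost_level_set:
  fixes h :: "real ^ 'n \<Rightarrow> real"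
  assumes h: "unit_cost_function h" and q: "\<And>i. 0 < q $ i" and c: "0 < c"
  shows "negligible {x \<in> interior nonneg_orthant. h (q * x) = c}"
proof -
  \<comment> \<open>Closed boxes inside the open orthant: on each of them \<open>h (q * x)\<close>
    is continuous, so its level set there is closed in the whole space.\<close>
  obtain D :: "(real ^ 'n) set set" where D: "countable D" "D \<subseteq> Pow (interior nonneg_orthant)"
    "\<And>X. X \<in> D \<Longrightarrow> \<exists>a b. X = cbox a b" "\<Union> D = interior nonneg_orthant"
    using open_countable_Union_open_cbox[OF open_interior] by metis
  have "negligible {x \<in> X. h (q * x) = c}" if "X \<in> D" for X
  proof -
    have sub: "X \<subseteq> interior nonneg_orthant"
      using D(2) that by blast
    show ?thesis
    proof (rule starlike_negligible[where a = 0])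
      have "closed X"
        using D(3)[OF that] by auto
      then show "closed {x \<in> X. h (q * x) = c}"
        using continuous_closed_preimage_constant[of X "\<lambda>x. h (q * x)" c]
          continuous_on_subset[OF continuous_on_unit_cost[OF h q] sub] by auto
    next
      \<comment> \<open>Two points \<open>x\<close> and \<open>k *\<^sub>R x\<close> on one ray both
        have cost \<open>c\<close>. Here \<open>k = 0\<close> is excluded because the origin is not
        in the interior; homogeneity then gives \<open>c = k * c\<close>.\<close>
      fix k :: real and x :: "real ^ 'n"
      assume kx: "0 + k *\<^sub>R x \<in> {x \<in> X. h (q * x) = c}" and k: "0 \<le> k"
        and x: "0 + x \<in> {x \<in> X. h (q * x) = c}"
      have pos: "\<forall>i. 0 < k * x $ i" "\<forall>i. 0 < x $ i"
        using subsetD[OF sub, of "k *\<^sub>R x"] subsetD[OF sub, of x] kx x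
        by (simp_all add: interior_nonneg_orthant)
      then have "0 < k"
        using k by (simp add: zero_less_mult_iff)
      moreover have "q * x \<in> nonneg_orthant"
        using q pos(2) by (simp add: nonneg_orthant_def less_imp_le)
      ultimately have "h (k *\<^sub>R (q * x)) = k * h (q * x)"
        using h by (simp add: unit_cost_function_def)
      moreover have "k *\<^sub>R (q * x) = q * (k *\<^sub>R x)"
        by (simp add: vec_eq_iff)
      moreover have "h (q * (k *\<^sub>R x)) = c" and "h (q * x) = c"
        using kx x by simp_all
      ultimately have "c = k * c"
        by metis
      then show "k = 1"
        using c by simp
    qed
  qed
  then have "negligible (\<Union>X\<in>D. {x \<in> X. h (q * x) = c})"
    using D(1) by (simp add: negligible_iff_null_sets null_sets_UN')
  moreover have "{x \<in> interior nonneg_orthant. h (q * x) = c} = (\<Union>X\<in>D. {x \<in> X. h (q * x) = c})"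
    using D(4) by auto
  ultimately show ?thesis
    by simp
qed

text \<open>Absolute continuity carries Lebesgue null sets over to \<open>\<mu>\<close>. Exceptional
  points are sought only in the orthant, since it is the whole space of
  \<open>\<mu>\<close>.\<close>

lemma AE_abs_cont_measure:
  assumes "abs_cont_measure \<mu>" and "negligible {x \<in> nonneg_orthant. \<not> P x}"
  shows "AE x in \<mu>. P x"
proof (rule AE_I')
  let ?N = "{x \<in> nonneg_orthant. \<not> P x}"
  have orthant: "(nonneg_orthant :: (real ^ 'n) set) \<in> sets lebesgue"
    using closed_positive_orthant by (simp add: nonneg_orthant_def borel_closed)
  have "?N \<in> null_sets (lebesgue_on nonneg_orthant)"
    using assms(2) orthant by (subst null_sets_restrict_space) (auto simp: negligible_iff_null_sets)
  then show "?N \<in> null_sets \<mu>"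
    using assms(1) by (auto simp: abs_cont_measure_def absolutely_continuous_def)
  have "space \<mu> = nonneg_orthant"
    using assms(1) sets_eq_imp_space_eq[of \<mu> "lebesgue_on nonneg_orthant"]
    by (simp add: abs_cont_measure_def)
  then show "{x \<in> space \<mu>. \<not> P x} \<subseteq> ?N"
    by simp
qed

lemma AE_mem_domain:
  assumes "abs_cont_measure \<mu>" and "unit_cost_function h"
    and "\<And>t. t \<in> {1..T} \<Longrightarrow> 0 < p0 t" and "\<And>t i. t \<in> {1..T} \<Longrightarrow> 0 < p t $ i"
  shows "AE x in \<mu>. \<exists>G \<in> domains h p0 p T. x \<in> G"
proof (rule AE_abs_cont_measure[OF assms(1)])
  let ?O = "nonneg_orthant :: (real ^ 'n) set"
  let ?H = "\<lambda>t. {x \<in> interior ?O. h (p t * x) = p0 t}"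
  have "negligible ((?O - interior ?O) \<union> (\<Union>t\<in>{1..T}. ?H t))"
  proof (rule negligible_Un[OF negligible_orthant_boundary negligible_Union])
    show "negligible X" if "X \<in> ?H ` {1..T}" for X
      using that negligible_unit_cost_level_set[OF assms(2) assms(4) assms(3)] by blast
  qed simp
  moreover have "\<exists>G \<in> domains h p0 p T. x \<in> G"
    if "x \<in> interior ?O" and "\<And>t. t \<in> {1..T} \<Longrightarrow> h (p t * x) \<noteq> p0 t" for x
  proof -
    \<comment> \<open>The only index set whose cell can contain \<open>x\<close>. At the remaining
      times the cost is strictly below \<open>p0 t\<close>, because \<open>x\<close> avoids all the
      hypersurfaces.\<close>
    let ?S = "{t \<in> {1..T}. p0 t < h (p t * x)}"
    have "x \<in> price_cell h p0 p T ?S"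
      using that by (fastforce simp: price_cell_def)
    then show ?thesis
      unfolding domains_def by blast
  qed
  then have "{x \<in> ?O. \<not> (\<exists>G \<in> domains h p0 p T. x \<in> G)}
      \<subseteq> (?O - interior ?O) \<union> (\<Union>t\<in>{1..T}. ?H t)"
    by blast
  ultimately show "negligible {x \<in> ?O. \<not> (\<exists>G \<in> domains h p0 p T. x \<in> G)}"
    by (rule negligible_subset)
qed

text \<open>Both sides are decided by whether \<open>t\<close> belongs to the index set
  \<open>S\<close> of the cell: inside \<open>S\<close> the argument of \<open>theta\<close> is
  negative, outside it is positive.\<close>

lemma theta_eq_spectrum_vector:
  assumes "G \<in> domains h p0 p T" and "x \<in> G" and "t \<in> {1..T}"
  shows "theta (p0 t - h (p t * x)) = spectrum_vector h p0 p t G"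
proof -
  obtain S where G: "G = price_cell h p0 p T S"
    using assms(1) by (auto simp: domains_def)
  then have "price_cell h p0 p T S \<noteq> {}"
    using assms(2) by blast
  then have "spectrum_vector h p0 p t G = (if t \<in> S then 0 else 1)"
    using assms(3) unfolding spectrum_vector_def G by (rule spectrum_price_cell)
  moreover have "p0 t < h (p t * x)" if "t \<in> S"
    using assms(2) that by (simp add: G price_cell_def)
  moreover have "h (p t * x) < p0 t" if "t \<notin> S"
    using assms(2,3) that by (simp add: G price_cell_def)
  ultimately show ?thesis
    by (fastforce simp: theta_def)
qed

theorem proposition5p2:
  fixes h :: "real ^ 'n \<Rightarrow> real"
    and y p0 :: "nat \<Rightarrow> real"
    and p :: "nat \<Rightarrow> real ^ 'n"
    and T :: nat
    and \<Omega>\<^sub>1 \<Omega>\<^sub>2 :: "nat set"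
  assumes "unit_cost_function h"
    and "\<And>t. t \<in> {1..T} \<Longrightarrow> 0 \<le> y t"
    and "\<And>t. t \<in> {1..T} \<Longrightarrow> 0 < p0 t"
    and "\<And>t i. t \<in> {1..T} \<Longrightarrow> 0 < p t $ i"
    and "\<exists>\<mu>. abs_cont_measure \<mu> \<and> solves_moment_problem h y p0 p T \<mu>"
    and "\<Omega>\<^sub>1 \<subseteq> {1..T}" and "\<Omega>\<^sub>2 \<subseteq> {1..T}"
    and "\<forall>G \<in> domains h p0 p T.
           (\<Sum>t\<in>\<Omega>\<^sub>1. spectrum_vector h p0 p t G) \<ge> (\<Sum>t\<in>\<Omega>\<^sub>2. spectrum_vector h p0 p t G)"
  shows "(\<Sum>t\<in>\<Omega>\<^sub>1. y t) \<ge> (\<Sum>t\<in>\<Omega>\<^sub>2. y t)"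
proof -
  obtain \<mu> where \<mu>: "abs_cont_measure \<mu>"
    and sol: "\<And>t. t \<in> {1..T} \<Longrightarrow> has_bochner_integral \<mu> (\<lambda>x. theta (p0 t - h (p t * x))) (y t)"
    using assms(5) by (auto simp: solves_moment_problem_def)
  let ?f = "\<lambda>\<Omega> x. \<Sum>t\<in>\<Omega>. theta (p0 t - h (p t * x))"
  have int: "has_bochner_integral \<mu> (?f \<Omega>) (\<Sum>t\<in>\<Omega>. y t)" if "\<Omega> \<subseteq> {1..T}" for \<Omega>
    using that sol by (intro has_bochner_integral_sum) auto
  have "AE x in \<mu>. \<exists>G \<in> domains h p0 p T. x \<in> G"
    using \<mu> assms(1,3,4) by (rule AE_mem_domain)
  then have "AE x in \<mu>. ?f \<Omega>\<^sub>2 x \<le> ?f \<Omega>\<^sub>1 x"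
  proof eventually_elim
    case (elim x)
    then obtain G where G: "G \<in> domains h p0 p T" "x \<in> G"
      by blast
    have "?f \<Omega> x = (\<Sum>t\<in>\<Omega>. spectrum_vector h p0 p t G)" if "\<Omega> \<subseteq> {1..T}" for \<Omega>
      using that theta_eq_spectrum_vector[OF G] by (intro sum.cong) auto
    then show ?case
      using assms(6-8) G(1) by simp
  qed
  \<comment> \<open>Integrability of both sums comes from \<open>int\<close>, so monotonicity
    applies even when \<open>\<mu>\<close> has infinite total mass.\<close>
  then have "integral\<^sup>L \<mu> (?f \<Omega>\<^sub>2) \<le> integral\<^sup>L \<mu> (?f \<Omega>\<^sub>1)"
    using int assms(6,7) by (intro integral_mono_AE) (auto simp: has_bochner_integral_iff)
  then show ?thesis
    using int[OF assms(6)] int[OF assms(7)] by (simp only: has_bochner_integral_integral_eq)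
qed

end
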